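(* Let $F$ be a field and $n\ge 1$ such that $\mathrm{char}(F)$ divides $n+1$, and consider the matrix $J_n+I_n\in F^{n\times n}$. If $a\in F$ and $a\neq 0,1$, then the twisted centralizer code $C(J_n+I_n,a)$ equals $\langle J_n\rangle$ (the $F$-span of $J_n$) and has parameters $[n^2,1,n^2]$.
   Context: $J_n$ denotes the $n\times n$ matrix with all entries equal to $1$ and $I_n$ the identity matrix. For $A\in F^{n\times n}$ and $a\in F$, $C(A,a):=\{B\in F^{n\times n}\mid AB=aBA\}$. The Hamming weight of a matrix in $F^{n\times n}$ is its number of nonzero entries. $C(A,a)$ has parameters $[n^2,k,d]$ where $k=\dim_F C(A,a)$ and $d$ is the minimal Hamming weight of a nonzero element of $C(A,a)$. *)

theory Defs
  imports "HOL-Analysis.Analysis"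
begin

definition mat_scale :: "'a::field \<Rightarrow> 'a^'n^'m \<Rightarrow> 'a^'n^'m" where
  "mat_scale c A = (\<chi> i j. c * A $ i $ j)"

interpretation mat_space: vector_space "mat_scale :: 'a::field \<Rightarrow> 'a^'n^'m \<Rightarrow> 'a^'n^'m"
  by unfold_locales (simp_all add: mat_scale_def vec_eq_iff algebra_simps)

definition all_ones :: "'a::field^'n^'n" where
  "all_ones = (\<chi> i j. 1)"

definition twisted_centralizer :: "'a::field^'n^'n \<Rightarrow> 'a \<Rightarrow> ('a^'n^'n) set" where
  "twisted_centralizer A a = {B. A ** B = mat_scale a (B ** A)}"

definition hamming_weight :: "'a::field^'n^'m \<Rightarrow> nat" where
  "hamming_weight B = card {(i, j). B $ i $ j \<noteq> 0}"

text \<open>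
  \<open>has_parameters C N k d\<close> says that \<open>C\<close> is a linear code with parameters \<open>[N, k, d]\<close>:
  the length \<open>N\<close> is the number of matrix positions. The minimum weight is stated relationally,
  so no value of \<open>d\<close> is attached to the zero code.
\<close>

definition has_parameters :: "('a::field^'n^'m) set \<Rightarrow> nat \<Rightarrow> nat \<Rightarrow> nat \<Rightarrow> bool" where
  "has_parameters C N k d \<longleftrightarrow>
     mat_space.subspace C \<and>
     N = CARD('m) * CARD('n) \<and>
     mat_space.dim C = k \<and>
     (\<exists>B\<in>C. B \<noteq> 0 \<and> hamming_weight B = d) \<and>
     (\<forall>B\<in>C. B \<noteq> 0 \<longrightarrow> d \<le> hamming_weight B)"

end

theory Submission
  imports Defs
begin

text \<open>
  Put \<open>A = J + I\<close> and let \<open>r\<^sub>i\<close>, \<open>c\<^sub>j\<close> and \<open>S\<close> be the row sums, the column sums and the total sum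
  of the entries of \<open>B\<close>. Multiplying by \<open>J\<close> on the left (right) replaces each entry by its column
  (row) sum, so \<open>AB = aBA\<close> says \<open>c\<^sub>j + b\<^sub>i\<^sub>j = a (r\<^sub>i + b\<^sub>i\<^sub>j)\<close> for all \<open>i\<close>, \<open>j\<close>. The hypothesis on the
  characteristic says that \<open>n = -1\<close> in the field. Summing the equations over \<open>i\<close> and cancelling \<open>a\<close>
  gives \<open>c\<^sub>j = -S\<close>; summing them over \<open>j\<close> gives \<open>r\<^sub>i = -S\<close>. Substituting back leaves
  \<open>(1 - a) b\<^sub>i\<^sub>j = (1 - a) S\<close>, so all entries of \<open>B\<close> are equal because \<open>a \<noteq> 1\<close>.
  Conversely \<open>J\<close> lies in the code because \<open>AJ = (n + 1) J = 0 = JA\<close>. Nonzero multiples of \<open>J\<close> have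
  full support, which gives the minimum weight.
\<close>

lemma of_nat_card_eq_minus_one:
  assumes "CHAR('a::field) dvd CARD('n::finite) + 1"
  shows "(of_nat CARD('n) :: 'a) = - 1"
proof -
  have "(of_nat (CARD('n) + 1) :: 'a) = 0"
    using assms of_nat_eq_0_iff_char_dvd by blast
  then show ?thesis
    by (simp add: eq_neg_iff_add_eq_0 add.commute)
qed

lemma twisted_centralizer_all_ones_iff:
  fixes B :: "'a::field^'n^'n"
  shows "B \<in> twisted_centralizer (all_ones + mat 1) a \<longleftrightarrow>
    (\<forall>i j. (\<Sum>k\<in>UNIV. B $ k $ j) + B $ i $ j = a * ((\<Sum>k\<in>UNIV. B $ i $ k) + B $ i $ j))"
proof -
  have "(all_ones + mat 1) ** B = all_ones ** B + mat 1 ** B"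
    by (simp add: matrix_matrix_mult_def vec_eq_iff distrib_right sum.distrib)
  then have "(all_ones + mat 1) ** B = all_ones ** B + B"
    by simp
  moreover have "B ** (all_ones + mat 1) = B ** all_ones + B"
    by (simp add: matrix_add_ldistrib)
  ultimately show ?thesis
    by (simp add: twisted_centralizer_def vec_eq_iff mat_scale_def all_ones_def
        matrix_matrix_mult_def)
qed

lemma constant_matrix_mem_twisted_centralizer:
  fixes c :: "'a::field"
  assumes "(of_nat CARD('n::finite) :: 'a) = - 1"
  shows "mat_scale c all_ones \<in> twisted_centralizer (all_ones + mat 1 :: 'a^'n^'n) a"
  unfolding twisted_centralizer_all_ones_iff
  by (simp add: mat_scale_def all_ones_def assms)

text \<open>
  The common value of the entries turns out to be their total sum \<open>S\<close>; this is consistent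
  since \<open>n\<^sup>2 S = (-1)\<^sup>2 S\<close>.
\<close>

lemma twisted_centralizer_all_ones_constant:
  fixes B :: "'a::field^'n^'n"
  assumes card: "(of_nat CARD('n) :: 'a) = - 1"
    and a: "a \<noteq> 0" "a \<noteq> 1"
    and B: "B \<in> twisted_centralizer (all_ones + mat 1) a"
  shows "B = mat_scale (\<Sum>i\<in>UNIV. \<Sum>j\<in>UNIV. B $ i $ j) all_ones"
proof -
  define r where "r i = (\<Sum>k\<in>UNIV. B $ i $ k)" for i
  define c where "c j = (\<Sum>k\<in>UNIV. B $ k $ j)" for j
  define S where "S = (\<Sum>i\<in>UNIV. r i)"
  have S': "(\<Sum>j\<in>UNIV. c j) = S"
    unfolding S_def r_def c_def by (rule sum.swap)
  have eq: "c j + B $ i $ j = a * (r i + B $ i $ j)" for i j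
    using B by (simp add: twisted_centralizer_all_ones_iff r_def c_def)
  have c: "c j = - S" for j
  proof -
    have "(\<Sum>i\<in>UNIV. c j + B $ i $ j) = (\<Sum>i\<in>UNIV. a * (r i + B $ i $ j))"
      by (simp only: eq)
    then have "- c j + c j = a * (S + c j)"
      by (simp add: sum.distrib card S_def flip: sum_distrib_left c_def)
    with a show ?thesis
      by (simp add: eq_neg_iff_add_eq_0 add.commute)
  qed
  have r: "r i = - S" for i
  proof -
    have "(\<Sum>j\<in>UNIV. c j + B $ i $ j) = (\<Sum>j\<in>UNIV. a * (r i + B $ i $ j))"
      by (simp only: eq)
    then have "S + r i = a * (- r i + r i)"
      by (simp add: sum.distrib card S' flip: sum_distrib_left r_def)
    then show ?thesis
      by (simp add: eq_neg_iff_add_eq_0 add.commute)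
  qed
  have "B $ i $ j = S" for i j
  proof -
    have "(1 - a) * (B $ i $ j - S) = 0"
      using eq[of j i] c r by (simp add: algebra_simps)
    with a show ?thesis by simp
  qed
  then have "B = mat_scale S all_ones"
    by (simp add: vec_eq_iff mat_scale_def all_ones_def)
  then show ?thesis
    by (simp only: S_def r_def)
qed

lemma hamming_weight_mat_scale_all_ones:
  assumes "c \<noteq> 0"
  shows "hamming_weight (mat_scale c all_ones :: 'a::field^'n^'n) = CARD('n)^2"
proof -
  have "{(i, j). (mat_scale c all_ones :: 'a^'n^'n) $ i $ j \<noteq> 0} = UNIV"
    using assms by (auto simp: mat_scale_def all_ones_def)
  then show ?thesis
    by (simp add: hamming_weight_def power2_eq_square)
qed

lemma has_parameters_span_all_ones:
  "has_parameters (mat_space.span {all_ones :: 'a::field^'n^'n}) (CARD('n)^2) 1 (CARD('n)^2)"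
proof -
  let ?J = "all_ones :: 'a^'n^'n"
  have nz: "?J \<noteq> 0"
    by (simp add: vec_eq_iff all_ones_def)
  then have "mat_space.dim (mat_space.span {?J}) = 1"
    by (subst mat_space.dim_span_eq_card_independent) simp_all
  moreover have "hamming_weight ?J = CARD('n)^2"
    using hamming_weight_mat_scale_all_ones[of "1::'a"] by simp
  moreover have "hamming_weight B = CARD('n)^2"
    if "B \<in> mat_space.span {?J}" and "B \<noteq> 0" for B
    using that by (auto simp: mat_space.span_singleton hamming_weight_mat_scale_all_ones)
  ultimately show ?thesis
    using nz unfolding has_parameters_def
    by (auto simp: power2_eq_square mat_space.span_base intro!: bexI[of _ ?J])
qed

theorem theorem3p2:
  fixes a :: "'a::field"
  assumes "CHAR('a) dvd CARD('n::finite) + 1"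
    and "a \<noteq> 0" and "a \<noteq> 1"
  shows "twisted_centralizer (all_ones + mat 1 :: 'a^'n^'n) a = mat_space.span {all_ones}
    \<and> has_parameters (twisted_centralizer (all_ones + mat 1 :: 'a^'n^'n) a)
        (CARD('n)^2) 1 (CARD('n)^2)"
proof -
  have card: "(of_nat CARD('n) :: 'a) = - 1"
    using assms(1) by (rule of_nat_card_eq_minus_one)
  have "twisted_centralizer (all_ones + mat 1 :: 'a^'n^'n) a = mat_space.span {all_ones}"
    using twisted_centralizer_all_ones_constant[OF card assms(2,3)]
      constant_matrix_mem_twisted_centralizer[OF card]
    by (auto simp: mat_space.span_singleton)
  then show ?thesis
    by (simp only: has_parameters_span_all_ones)
qed

end
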